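(* Let $a_1,a_2,\ldots,a_{n+1}\in\mathbb{R}^n$ be the vertices of a non-degenerate simplex $\Sigma$ in $\mathbb{R}^n$ whose centre of mass is at the origin (i.e. $a_1+\cdots+a_{n+1}=0$). Let $A$ be the $n\times(n+1)$ matrix with columns $a_1,\ldots,a_{n+1}$ and let $$Q=A^t(AA^t)^{-2}A .$$ Points $z_1,z_2,\ldots,z_n,z_{n+1}\in\mathbb{C}$ are the images under orthogonal projection of the vertices of a simplex similar to $\Sigma$ if and only if $$z^tQz=0,$$ where $z$ is the column vector with components $z_1,z_2,\ldots,z_n,z_{n+1}$.
   Context: The orthogonal projection is the standard projection $P:\mathbb{R}^n\to\mathbb{R}^2$ onto the first two coordinates, with $\mathbb{R}^2$ identified with $\mathbb{C}$ via $(x,y)\mapsto x+iy$. The superscript $t$ denotes transpose (without complex conjugation). Since $\Sigma$ is non-degenerate, $A$ has rank $n$, so $AA^t$ is invertible. Two non-degenerate simplices in $\mathbb{R}^n$ are similar if one can be obtained from the other by a Euclidean motion (an orthogonal transformation followed by a translation) together with an overall scaling. That $z_1,\ldots,z_{n+1}$ are the images of the vertices means that $z_j$ is the image under $P$ of the vertex of the similar simplex corresponding to $a_j$, for $j=1,\ldots,n+1$.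
   Formalization: The condition z^tQz=0 is supplemented by the requirement that z_1,...,z_{n+1} are not all equal: constant z satisfies z^tQz=0 but is never the image of a non-degenerate simplex. *)

theory Defs
  imports "HOL-Analysis.Analysis"
begin

(* A simplex with labelled vertices is a family of points indexed by 'm.  It spans the whole
   of R^n exactly when CARD('m) = CARD('n) + 1; the cardinality is assumed where it is needed.
   Injectivity is required separately because the range forgets repeated vertices. *)
definition nondegenerate_simplex :: "('m::finite \<Rightarrow> real ^ 'n) \<Rightarrow> bool" where
  "nondegenerate_simplex a \<longleftrightarrow> inj a \<and> \<not> affine_dependent (range a)"

definition euclidean_motion :: "(real ^ 'n \<Rightarrow> real ^ 'n) \<Rightarrow> bool" where
  "euclidean_motion g \<longleftrightarrow> (\<exists>f c. orthogonal_transformation f \<and> g = (\<lambda>x. f x + c))"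

(* The vertex b j corresponds to the vertex a j.  The scale factor is positive, so that the
   simplex is never collapsed to a point; orientation-reversing motions are allowed. *)
definition similar_simplices ::
    "('m::finite \<Rightarrow> real ^ 'n) \<Rightarrow> ('m \<Rightarrow> real ^ 'n) \<Rightarrow> bool" where
  "similar_simplices a b \<longleftrightarrow>
     nondegenerate_simplex a \<and> nondegenerate_simplex b \<and>
     (\<exists>g r. euclidean_motion g \<and> r > 0 \<and> (\<forall>j. b j = r *\<^sub>R g (a j)))"

definition first_coord :: "'n::{finite,linorder}" where
  "first_coord = Min UNIV"

(* Only meaningful if CARD('n) \<ge> 2. *)
definition second_coord :: "'n::{finite,linorder}" where
  "second_coord = Min (UNIV - {first_coord})"

definition proj :: "real ^ 'n::{finite,linorder} \<Rightarrow> complex" where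
  "proj x = Complex (x $ first_coord) (x $ second_coord)"

definition vertex_matrix :: "('m::finite \<Rightarrow> real ^ 'n) \<Rightarrow> real ^ 'm ^ 'n" where
  "vertex_matrix a = (\<chi> i j. a j $ i)"

definition Q_matrix :: "real ^ 'm ^ 'n \<Rightarrow> real ^ 'm ^ 'm" where
  "Q_matrix A =
     (let B = matrix_inv (A ** transpose A) in transpose A ** (B ** B) ** A)"

(* z^t M z, without complex conjugation (so not an inner product on complex ^ 'm). *)
definition complex_quadratic_form :: "real ^ 'm ^ 'm \<Rightarrow> complex ^ 'm \<Rightarrow> complex" where
  "complex_quadratic_form M z =
     (\<Sum>i\<in>UNIV. z $ i * (map_matrix complex_of_real M *v z) $ i)"

end

theory Submission
  imports Defs
begin

text \<open>
  A family \<open>x\<close> of real values at the vertices of a non-degenerate simplex is interpolated by exactly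
  one affine function \<open>p \<mapsto> p \<bullet> u + c\<close>, and because the centre of mass is the origin its linear part
  is \<open>u = (A A\<^sup>t)\<inverse> A x\<close> (lemma \<open>affine_function_iff_gradient\<close>). Since \<open>Q\<close> factors as
  \<open>((A A\<^sup>t)\<inverse> A)\<^sup>t ((A A\<^sup>t)\<inverse> A)\<close>, writing \<open>u\<close> and \<open>v\<close> for the linear parts belonging to the real and
  imaginary parts of \<open>z\<close> gives
  \<open>z\<^sup>t Q z = u \<bullet> u - v \<bullet> v + 2 \<i> (u \<bullet> v)\<close> (lemma \<open>quadratic_form_via_gradients\<close>). So the
  equation \<open>z\<^sup>t Q z = 0\<close> says that \<open>u\<close> and \<open>v\<close> are orthogonal and of equal length.

  The affine map sending each vertex to its image \<open>z\<^sub>j\<close> is the projection of a similarity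
  precisely when \<open>u\<close> and \<open>v\<close> arise from the first two coordinate vectors by the transpose of an
  orthogonal map, multiplied by the scale \<open>r > 0\<close>. This forces \<open>u \<bullet> v = 0\<close> and
  \<open>norm u = norm v = r\<close>. Conversely, an orthogonal pair of common length \<open>r > 0\<close> can be carried to the
  coordinate pair by two reflections (lemma \<open>orthogonal_transformation_orthonormal_pair\<close>), the
  constant terms of the two affine functions giving the translation. The constant families \<open>z\<close>
  are those with \<open>u = v = 0\<close>: they satisfy the equation, but only with the excluded scale \<open>r = 0\<close>.
\<close>

section \<open>Affine dependence relations of a labelled simplex\<close>

text \<open>
  Affine dependence of the range does not see coefficients of repeated points; labelling the
  coefficients by the index type absorbs the injectivity requirement, since two coinciding vertices
  are related by the coefficients \<open>1\<close> and \<open>-1\<close>.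
\<close>
lemma nondegenerate_simplex_iff:
  fixes a :: "'m::finite \<Rightarrow> real ^ 'n"
  shows "nondegenerate_simplex a \<longleftrightarrow>
    (\<forall>g. (\<Sum>j\<in>UNIV. g j) = 0 \<and> (\<Sum>j\<in>UNIV. g j *\<^sub>R a j) = 0 \<longrightarrow> (\<forall>j. g j = 0))"
    (is "?L \<longleftrightarrow> ?R")
proof
  assume L: ?L
  then have inj: "inj a" and indep: "\<not> affine_dependent (range a)"
    by (auto simp: nondegenerate_simplex_def)
  show ?R
  proof (intro allI impI, elim conjE)
    fix g j
    assume g: "(\<Sum>j\<in>UNIV. g j) = 0" "(\<Sum>j\<in>UNIV. g j *\<^sub>R a j) = 0"
    define U where "U v = g (inv a v)" for v
    have U: "U (a k) = g k" for k
      by (simp add: U_def inj)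
    have "sum U (range a) = 0" "(\<Sum>v\<in>range a. U v *\<^sub>R v) = 0"
      using g by (simp_all add: sum.reindex[OF inj] U)
    then have "U v = 0" if "v \<in> range a" for v
      using indep that by (auto simp: affine_dependent_explicit_finite)
    then show "g j = 0"
      using U[of j] by (metis rangeI)
  qed
next
  assume R: ?R
  have inj: "inj a"
  proof (rule injI, rule ccontr)
    fix i j assume eq: "a i = a j" and ne: "i \<noteq> j"
    define g :: "'m \<Rightarrow> real" where "g k = (if k = i then 1 else 0) - (if k = j then 1 else 0)" for k
    have "(\<Sum>k\<in>UNIV. g k) = 0"
      by (simp add: g_def sum_subtractf)
    moreover have "(\<Sum>k\<in>UNIV. g k *\<^sub>R a k) = 0"
      by (simp add: g_def sum_subtractf scaleR_left_diff_distrib if_distrib[of "\<lambda>t. t *\<^sub>R _"] eq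
               cong: if_cong)
    ultimately have "g i = 0"
      using R by blast
    then show False
      using ne by (simp add: g_def)
  qed
  have "\<not> affine_dependent (range a)"
  proof
    assume "affine_dependent (range a)"
    then obtain U v where U: "sum U (range a) = 0" "(\<Sum>v\<in>range a. U v *\<^sub>R v) = 0"
      and v: "v \<in> range a" "U v \<noteq> 0"
      by (auto simp: affine_dependent_explicit_finite)
    have "(\<Sum>j\<in>UNIV. U (a j)) = 0" "(\<Sum>j\<in>UNIV. U (a j) *\<^sub>R a j) = 0"
      using U by (simp_all add: sum.reindex[OF inj])
    then have "\<forall>j. U (a j) = 0"
      using R[rule_format, of "\<lambda>j. U (a j)"] by blast
    then show False
      using v by auto
  qed
  then show ?L
    using inj by (simp add: nondegenerate_simplex_def)
qed

lemma nondegenerate_simplex_similarity: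
  fixes a :: "'m::finite \<Rightarrow> real ^ 'n"
  assumes a: "nondegenerate_simplex a" and f: "orthogonal_transformation f" and r: "r \<noteq> 0"
  shows "nondegenerate_simplex (\<lambda>j. r *\<^sub>R (f (a j) + c))"
  unfolding nondegenerate_simplex_iff
proof (intro allI impI, elim conjE)
  fix g j
  assume g: "(\<Sum>j\<in>UNIV. g j) = 0" "(\<Sum>j\<in>UNIV. g j *\<^sub>R r *\<^sub>R (f (a j) + c)) = 0"
  have lin: "linear f"
    using f by (rule orthogonal_transformation_linear)
  have "(\<Sum>j\<in>UNIV. g j *\<^sub>R r *\<^sub>R (f (a j) + c))
      = r *\<^sub>R ((\<Sum>j\<in>UNIV. g j *\<^sub>R f (a j)) + (\<Sum>j\<in>UNIV. g j) *\<^sub>R c)"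
    by (simp add: scaleR_sum_right scaleR_sum_left scaleR_add_right sum.distrib mult.commute)
  also have "\<dots> = r *\<^sub>R f (\<Sum>j\<in>UNIV. g j *\<^sub>R a j)"
    using g by (simp add: linear_sum[OF lin] linear_scale[OF lin])
  finally have "f (\<Sum>j\<in>UNIV. g j *\<^sub>R a j) = 0"
    using g r by simp
  then have "(\<Sum>j\<in>UNIV. g j *\<^sub>R a j) = 0"
    using orthogonal_transformation_norm[OF f] by (metis norm_eq_zero)
  then show "g j = 0"
    using a g unfolding nondegenerate_simplex_iff by blast
qed

text \<open>
  Subtracting the mean turns a linear relation into an affine one, because the points themselves
  sum to zero; so the constant families are the only linear relations.
\<close>
lemma linear_relation_constant:
  fixes a :: "'m::finite \<Rightarrow> real ^ 'n"
  assumes a: "nondegenerate_simplex a" and centre: "(\<Sum>j\<in>UNIV. a j) = 0"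
    and g: "(\<Sum>j\<in>UNIV. g j *\<^sub>R a j) = 0"
  shows "\<exists>c. \<forall>j. g j = c"
proof -
  define c where "c = (\<Sum>j\<in>UNIV. g j) / real CARD('m)"
  have "(\<Sum>j\<in>UNIV. g j - c) = 0"
    by (simp add: sum_subtractf c_def)
  moreover have "(\<Sum>j\<in>UNIV. (g j - c) *\<^sub>R a j) = 0"
    using g centre by (simp add: scaleR_left_diff_distrib sum_subtractf flip: scaleR_sum_right)
  ultimately have "\<forall>j. g j - c = 0"
    using a unfolding nondegenerate_simplex_iff by blast
  then show ?thesis
    by auto
qed

lemma simplex_span:
  fixes a :: "'m::finite \<Rightarrow> real ^ 'n"
  assumes "nondegenerate_simplex a" "CARD('m) = CARD('n) + 1"
  shows "span (range a) = UNIV"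
proof -
  have "card (range a) = Suc DIM(real ^ 'n)"
    using assms by (simp add: nondegenerate_simplex_def card_image)
  then have "affine hull range a = UNIV"
    using assms by (intro affine_independent_span_eq) (simp_all add: nondegenerate_simplex_def)
  then show ?thesis
    using affine_hull_subset_span[of "range a"] by auto
qed

section \<open>The linear part of the affine interpolation of vertex values\<close>

definition interpolation_gradient :: "('m::finite \<Rightarrow> real ^ 'n) \<Rightarrow> real ^ 'm \<Rightarrow> real ^ 'n" where
  "interpolation_gradient a x =
     matrix_inv (vertex_matrix a ** transpose (vertex_matrix a)) *v (vertex_matrix a *v x)"

lemma vertex_matrix_mult: "vertex_matrix a *v x = (\<Sum>j\<in>UNIV. x $ j *\<^sub>R a j)"
  by (simp add: vec_eq_iff vertex_matrix_def matrix_vector_mult_def mult.commute)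

lemma mult_vertex_matrix: "(p v* vertex_matrix a) $ j = p \<bullet> a j"
  by (simp add: vertex_matrix_def vector_matrix_mult_def inner_vec_def mult.commute)

text \<open>
  The kernel of \<open>A A\<^sup>t\<close> is that of \<open>A\<^sup>t\<close>, which consists of the vectors orthogonal to all vertices;
  these span the whole space.
\<close>
lemma invertible_vertex_gram:
  fixes a :: "'m::finite \<Rightarrow> real ^ 'n"
  assumes "nondegenerate_simplex a" "CARD('m) = CARD('n) + 1"
  shows "invertible (vertex_matrix a ** transpose (vertex_matrix a))"
  unfolding invertible_left_inverse matrix_left_invertible_ker
proof (intro allI impI)
  let ?A = "vertex_matrix a"
  fix p assume "(?A ** transpose ?A) *v p = 0"
  then have "?A *v (p v* ?A) = 0"
    by (simp flip: matrix_vector_mul_assoc)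
  then have "(p v* ?A) \<bullet> (p v* ?A) = 0"
    by (simp add: dot_lmul_matrix)
  then have "p \<bullet> a j = 0" for j
    using mult_vertex_matrix[of p a j] by simp
  then have orth: "orthogonal p x" if "x \<in> range a" for x
    using that by (auto simp: orthogonal_def)
  have "p \<in> span (range a)"
    by (simp add: simplex_span[OF assms])
  then have "orthogonal p p"
    using orth by (rule orthogonal_to_span)
  then show "p = 0"
    by (simp add: orthogonal_def)
qed

lemma matrix_inv_mult_cancel:
  fixes M :: "real ^ 'n ^ 'n"
  assumes "invertible M"
  shows "matrix_inv M *v (M *v x) = x" "M *v (matrix_inv M *v x) = x"
proof -
  obtain M' where "M ** M' = mat 1 \<and> M' ** M = mat 1"
    using assms by (auto simp: invertible_def)
  then have "M ** matrix_inv M = mat 1 \<and> matrix_inv M ** M = mat 1"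
    unfolding matrix_inv_def by (rule someI)
  then show "matrix_inv M *v (M *v x) = x" "M *v (matrix_inv M *v x) = x"
    by (simp_all add: matrix_vector_mul_assoc)
qed

text \<open>
  Applying \<open>A\<close> to \<open>x = A\<^sup>t p + c\<close> kills the constant, because the centre of mass is the origin, and
  leaves \<open>A x = A A\<^sup>t p\<close>. Conversely, \<open>x - A\<^sup>t u\<close> for the gradient \<open>u\<close> is a linear relation among
  the vertices, hence constant.
\<close>
lemma affine_function_iff_gradient:
  fixes a :: "'m::finite \<Rightarrow> real ^ 'n"
  assumes a: "nondegenerate_simplex a" and card: "CARD('m) = CARD('n) + 1"
    and centre: "(\<Sum>j\<in>UNIV. a j) = 0"
  shows "(\<exists>c. \<forall>j. x $ j = p \<bullet> a j + c) \<longleftrightarrow> p = interpolation_gradient a x"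
    (is "?L \<longleftrightarrow> ?R")
proof -
  let ?A = "vertex_matrix a"
  note cancel = matrix_inv_mult_cancel[OF invertible_vertex_gram[OF a card]]
  show ?thesis
  proof
    assume ?L
    then obtain c where c: "\<And>j. x $ j = p \<bullet> a j + c"
      by blast
    have "x = p v* ?A + (\<chi> j. c)"
      by (simp add: vec_eq_iff mult_vertex_matrix c)
    then have "?A *v x = (?A ** transpose ?A) *v p + ?A *v (\<chi> j. c)"
      by (simp add: matrix_vector_right_distrib flip: matrix_vector_mul_assoc)
    also have "?A *v (\<chi> j. c) = 0"
      by (simp add: vertex_matrix_mult centre flip: scaleR_sum_right)
    finally show ?R
      by (simp add: interpolation_gradient_def cancel)
  next
    assume ?R
    define y where "y = x - p v* ?A"
    have "?A *v y = ?A *v x - (?A ** transpose ?A) *v p"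
      by (simp add: y_def matrix_vector_mult_diff_distrib flip: matrix_vector_mul_assoc)
    also have "\<dots> = 0"
      using \<open>?R\<close> by (simp add: interpolation_gradient_def cancel)
    finally have "(\<Sum>j\<in>UNIV. y $ j *\<^sub>R a j) = 0"
      by (simp add: vertex_matrix_mult)
    from linear_relation_constant[OF a centre this] obtain c where "\<And>j. y $ j = c"
      by blast
    then have "x $ j = p \<bullet> a j + c" for j
      by (simp add: y_def mult_vertex_matrix algebra_simps)
    then show ?L
      by blast
  qed
qed

lemma gradient_eq_0_iff_constant:
  fixes a :: "'m::finite \<Rightarrow> real ^ 'n"
  assumes "nondegenerate_simplex a" "CARD('m) = CARD('n) + 1" "(\<Sum>j\<in>UNIV. a j) = 0"
  shows "interpolation_gradient a x = 0 \<longleftrightarrow> (\<exists>c. \<forall>j. x $ j = c)"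
  by (subst eq_commute) (simp flip: affine_function_iff_gradient[OF assms])

section \<open>The quadratic form in terms of gradients\<close>

lemma Q_matrix_bilinear:
  fixes a :: "'m::finite \<Rightarrow> real ^ 'n"
  assumes "nondegenerate_simplex a" "CARD('m) = CARD('n) + 1"
  shows "x \<bullet> (Q_matrix (vertex_matrix a) *v y) =
    interpolation_gradient a x \<bullet> interpolation_gradient a y"
proof -
  let ?A = "vertex_matrix a"
  define G where "G = ?A ** transpose ?A"
  define B where "B = matrix_inv G"
  note cancel = matrix_inv_mult_cancel[OF invertible_vertex_gram[OF assms], folded G_def, folded B_def]
  have G_sym: "(G *v p) \<bullet> q = p \<bullet> (G *v q)" for p q
  proof -
    have "transpose G = G"
      by (simp add: G_def matrix_transpose_mul)
    then show ?thesis
      by (metis dot_lmul_matrix transpose_matrix_vector)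
  qed
  have B_sym: "(B *v p) \<bullet> q = p \<bullet> (B *v q)" for p q
    using G_sym[of "B *v p" "B *v q"] by (simp add: cancel)
  have "x \<bullet> (Q_matrix ?A *v y) = ((B *v (B *v (?A *v y))) v* ?A) \<bullet> x"
    by (simp add: Q_matrix_def Let_def G_def B_def inner_commute[of x] flip: matrix_vector_mul_assoc)
  also have "\<dots> = (?A *v x) \<bullet> (B *v (B *v (?A *v y)))"
    by (metis dot_lmul_matrix inner_commute)
  also have "\<dots> = (B *v (?A *v x)) \<bullet> (B *v (?A *v y))"
    by (simp add: B_sym)
  finally show ?thesis
    by (simp add: interpolation_gradient_def B_def G_def)
qed

lemma complex_quadratic_form_Re_Im:
  fixes M :: "real ^ 'm ^ 'm"
  assumes x: "x = (\<chi> j. Re (z $ j))" and y: "y = (\<chi> j. Im (z $ j))"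
  shows "complex_quadratic_form M z =
    Complex (x \<bullet> (M *v x) - y \<bullet> (M *v y)) (x \<bullet> (M *v y) + y \<bullet> (M *v x))"
proof -
  have "(map_matrix complex_of_real M *v z) $ i = Complex ((M *v x) $ i) ((M *v y) $ i)" for i
    by (simp add: complex_eq_iff matrix_vector_mult_def map_matrix_def x y)
  then show ?thesis
    by (simp add: complex_quadratic_form_def complex_eq_iff inner_vec_def x y
                  sum.distrib sum_subtractf)
qed

lemma quadratic_form_via_gradients:
  fixes a :: "'m::finite \<Rightarrow> real ^ 'n"
  assumes "nondegenerate_simplex a" "CARD('m) = CARD('n) + 1"
    and u: "u = interpolation_gradient a (\<chi> j. Re (z $ j))"
    and v: "v = interpolation_gradient a (\<chi> j. Im (z $ j))"
  shows "complex_quadratic_form (Q_matrix (vertex_matrix a)) z =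
    Complex (u \<bullet> u - v \<bullet> v) (2 * (u \<bullet> v))"
  unfolding complex_quadratic_form_Re_Im[OF refl refl] Q_matrix_bilinear[OF assms(1,2)] u v
  by (simp add: inner_commute)

section \<open>Moving an orthonormal pair by an orthogonal transformation\<close>

text \<open>For \<open>d = 0\<close>, division by zero makes this the identity, which moves a vector to itself.\<close>
definition reflection_along :: "'a::real_inner \<Rightarrow> 'a \<Rightarrow> 'a" where
  "reflection_along d x = x - (2 * (x \<bullet> d) / (d \<bullet> d)) *\<^sub>R d"

lemma orthogonal_transformation_reflection_along:
  "orthogonal_transformation (reflection_along d)"
proof (cases "d = 0")
  case False
  then show ?thesis
    unfolding orthogonal_transformation_def reflection_along_def
    by (auto intro!: linearI simp: algebra_simps inner_simps inner_commute add_divide_distrib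
        scaleR_left_distrib)
qed (simp add: reflection_along_def[abs_def])

lemma reflection_along_fixes: "x \<bullet> d = 0 \<Longrightarrow> reflection_along d x = x"
  by (simp add: reflection_along_def)

text \<open>For vectors of equal length, \<open>2 (x \<bullet> (x - y)) = (x - y) \<bullet> (x - y)\<close>.\<close>
lemma reflection_along_diff:
  assumes "norm x = norm y"
  shows "reflection_along (x - y) x = y"
proof (cases "x = y")
  case False
  have "x \<bullet> x = y \<bullet> y"
    using assms by (simp add: norm_eq)
  then have "2 * (x \<bullet> (x - y)) = (x - y) \<bullet> (x - y)"
    by (simp add: inner_simps inner_commute)
  then show ?thesis
    using False by (simp add: reflection_along_def)
qed (simp add: reflection_along_def)

text \<open>
  After one reflection has moved \<open>u\<close> to \<open>e\<close>, the reflection that moves the image of \<open>v\<close> to \<open>e'\<close>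
  fixes \<open>e\<close>, because \<open>e\<close> is orthogonal to both.
\<close>
lemma orthogonal_transformation_orthonormal_pair:
  fixes u v e e' :: "'a::euclidean_space"
  assumes "norm u = norm e" "norm v = norm e'" "u \<bullet> v = 0" "e \<bullet> e' = 0"
  obtains f where "orthogonal_transformation f" "f u = e" "f v = e'"
proof -
  let ?f = "reflection_along (u - e)"
  let ?g = "reflection_along (?f v - e')"
  note orth = orthogonal_transformation_reflection_along
  have fu: "?f u = e"
    using assms by (simp add: reflection_along_diff)
  have "e \<bullet> ?f v = u \<bullet> v"
    using orth[of "u - e"] fu unfolding orthogonal_transformation_def by metis
  then have "e \<bullet> (?f v - e') = 0"
    using assms by (simp add: inner_diff_right)
  then have gu: "(?g \<circ> ?f) u = e"
    by (simp add: fu reflection_along_fixes)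
  have "norm (?f v) = norm e'"
    using assms orthogonal_transformation_norm[OF orth] by metis
  then have gv: "(?g \<circ> ?f) v = e'"
    by (simp add: reflection_along_diff)
  have "orthogonal_transformation (?g \<circ> ?f)"
    by (intro orthogonal_transformation_compose orth)
  then show thesis
    using gu gv by (rule that)
qed

section \<open>Projections of similar simplices\<close>

lemma first_coord_neq_second_coord:
  assumes "CARD('n::{finite,linorder}) \<ge> 2"
  shows "(first_coord :: 'n) \<noteq> second_coord"
proof -
  have "card (UNIV - {first_coord :: 'n}) \<noteq> 0"
    using assms by (simp add: card_Diff_singleton)
  then have "UNIV - {first_coord :: 'n} \<noteq> {}"
    by (metis card.empty)
  then have "second_coord \<in> UNIV - {first_coord :: 'n}"
    unfolding second_coord_def by (intro Min_in) simp_all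
  then show ?thesis
    by auto
qed

theorem corollary1:
  fixes a :: "'m::finite \<Rightarrow> real ^ 'n::{finite,linorder}"
    and z :: "complex ^ 'm"
  assumes "CARD('n) \<ge> 2"
    and "CARD('m) = CARD('n) + 1"
    and "nondegenerate_simplex a"
    and "(\<Sum>j\<in>UNIV. a j) = 0"
  shows "(\<exists>b. similar_simplices a b \<and> (\<forall>j. z $ j = proj (b j))) \<longleftrightarrow>
         complex_quadratic_form (Q_matrix (vertex_matrix a)) z = 0 \<and>
         \<not> (\<exists>c. \<forall>j. z $ j = c)"
    (is "?L \<longleftrightarrow> ?R")
proof -
  define x where "x = (\<chi> j. Re (z $ j))"
  define y where "y = (\<chi> j. Im (z $ j))"
  define u where "u = interpolation_gradient a x"
  define v where "v = interpolation_gradient a y"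
  define e1 :: "real ^ 'n::{finite,linorder}" where "e1 = axis first_coord 1"
  define e2 :: "real ^ 'n::{finite,linorder}" where "e2 = axis second_coord 1"
  have e: "e1 \<bullet> e1 = 1" "e2 \<bullet> e2 = 1" "e1 \<bullet> e2 = 0" "e2 \<bullet> e1 = 0"
    using first_coord_neq_second_coord[OF assms(1)]
    by (auto simp: e1_def e2_def inner_axis_axis)
  have coord: "w $ first_coord = w \<bullet> e1" "w $ second_coord = w \<bullet> e2" for w :: "real ^ 'n::{finite,linorder}"
    by (simp_all add: e1_def e2_def inner_axis)
  have z_proj: "z $ j = proj w \<longleftrightarrow> x $ j = w \<bullet> e1 \<and> y $ j = w \<bullet> e2" for j w
    by (simp add: x_def y_def proj_def complex_eq_iff coord)
  note affine = affine_function_iff_gradient[OF assms(3,2,4)]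
  note const = gradient_eq_0_iff_constant[OF assms(3,2,4)]
  have form: "complex_quadratic_form (Q_matrix (vertex_matrix a)) z = 0 \<longleftrightarrow>
      u \<bullet> u = v \<bullet> v \<and> u \<bullet> v = 0"
    using quadratic_form_via_gradients[OF assms(3,2) u_def[unfolded x_def] v_def[unfolded y_def]]
    by (simp add: complex_eq_iff)
  \<comment> \<open>This identifies the families that the scale \<open>r = 0\<close> would produce.\<close>
  have z_const: "(\<exists>c. \<forall>j. z $ j = c) \<longleftrightarrow> u = 0 \<and> v = 0"
  proof -
    have "(\<exists>c. \<forall>j. z $ j = c) \<longleftrightarrow> (\<exists>c. \<forall>j. x $ j = c) \<and> (\<exists>d. \<forall>j. y $ j = d)"
    proof safe
      fix c d assume "\<forall>j. x $ j = c" "\<forall>j. y $ j = d"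
      then have "\<forall>j. z $ j = Complex c d"
        by (simp add: x_def y_def complex_eq_iff)
      then show "\<exists>c. \<forall>j. z $ j = c" ..
    qed (auto simp: x_def y_def)
    then show ?thesis
      by (simp add: u_def v_def const)
  qed
  show ?thesis
  proof
    assume ?L
    then obtain b g r where "euclidean_motion g" and r: "r > 0"
      and bg: "\<forall>j. b j = r *\<^sub>R g (a j)" and z: "\<forall>j. z $ j = proj (b j)"
      unfolding similar_simplices_def by blast
    then obtain f t where f: "orthogonal_transformation f" and g: "g = (\<lambda>p. f p + t)"
      unfolding euclidean_motion_def by blast
    have b: "b j = r *\<^sub>R (f (a j) + t)" for j
      using bg by (simp add: g)
    note inv_f = orthogonal_transformation_inv[OF f]
    \<comment> \<open>The inverse of \<open>f\<close> is its transpose, so it carries the coordinate vectors to the gradients divided by \<open>r\<close>.\<close>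
    have adj: "f p \<bullet> q = inv f q \<bullet> p" for p q
    proof -
      have "f p \<bullet> f (inv f q) = p \<bullet> inv f q"
        using f by (simp add: orthogonal_transformation_def)
      then show ?thesis
        using orthogonal_transformation_surj[OF f] by (simp add: surj_f_inv_f inner_commute)
    qed
    have xy: "x $ j = (r *\<^sub>R inv f e1) \<bullet> a j + r * (t \<bullet> e1)"
      "y $ j = (r *\<^sub>R inv f e2) \<bullet> a j + r * (t \<bullet> e2)" for j
      using z[rule_format, of j] by (simp_all add: z_proj b inner_add_left adj distrib_left)
    have "u = r *\<^sub>R inv f e1"
      unfolding u_def using xy by (intro affine[THEN iffD1, symmetric] exI allI)
    moreover have "v = r *\<^sub>R inv f e2"
      unfolding v_def using xy by (intro affine[THEN iffD1, symmetric] exI allI)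
    ultimately have "u \<bullet> u = r * r" "v \<bullet> v = r * r" "u \<bullet> v = 0"
      using inv_f by (simp_all add: orthogonal_transformation_def e)
    then show ?R
      using r unfolding form z_const by auto
  next
    assume ?R
    then have uv: "u \<bullet> u = v \<bullet> v" "u \<bullet> v = 0" and ne: "u \<noteq> 0 \<or> v \<noteq> 0"
      by (auto simp: form z_const)
    define r where "r = norm u"
    have norm_v: "norm v = r"
      using uv by (simp add: r_def norm_eq)
    then have r: "r > 0"
      using ne by (auto simp: r_def)
    have "norm (u /\<^sub>R r) = norm e1" "norm (v /\<^sub>R r) = norm e2" "(u /\<^sub>R r) \<bullet> (v /\<^sub>R r) = 0"
      using r norm_v uv by (simp_all add: norm_eq_sqrt_inner[of e1] norm_eq_sqrt_inner[of e2] e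
                                     flip: r_def)
    from orthogonal_transformation_orthonormal_pair[OF this e(3)]
    obtain f where f: "orthogonal_transformation f" "f (u /\<^sub>R r) = e1" "f (v /\<^sub>R r) = e2"
      by blast
    obtain c where c: "\<And>j. x $ j = u \<bullet> a j + c"
      using affine[THEN iffD2, OF u_def] by blast
    obtain d where d: "\<And>j. y $ j = v \<bullet> a j + d"
      using affine[THEN iffD2, OF v_def] by blast
    \<comment> \<open>The scale \<open>r\<close> is applied after the translation, so the constant terms are divided by it.\<close>
    define t where "t = (c / r) *\<^sub>R e1 + (d / r) *\<^sub>R e2"
    define b where "b j = r *\<^sub>R (f (a j) + t)" for j
    have fe: "f p \<bullet> e1 = u \<bullet> p / r" "f p \<bullet> e2 = v \<bullet> p / r" for p
    proof -
      have "f p \<bullet> f q = p \<bullet> q" for q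
        using f(1) by (simp add: orthogonal_transformation_def)
      from this[of "u /\<^sub>R r"] this[of "v /\<^sub>R r"]
      show "f p \<bullet> e1 = u \<bullet> p / r" "f p \<bullet> e2 = v \<bullet> p / r"
        by (simp_all add: f(2,3) divide_inverse mult.commute inner_commute[of p])
    qed
    have "similar_simplices a b"
      unfolding similar_simplices_def
    proof (intro conjI exI allI)
      show "nondegenerate_simplex b"
        unfolding b_def using assms(3) f(1) r by (intro nondegenerate_simplex_similarity) auto
      show "euclidean_motion (\<lambda>p. f p + t)"
        using f(1) by (auto simp: euclidean_motion_def)
    qed (use assms(3) r b_def in auto)
    moreover have "z $ j = proj (b j)" for j
      using r by (simp add: z_proj b_def t_def inner_add_left fe e c d distrib_left)
    ultimately show ?L
      by blast
  qed
qed

end
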